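(* Let $(X,T)$ be a dynamical system. Then the following statements are equivalent: (1) $(X,T)$ is weakly mixing; (2) $(K(X),T_K)$ is transitive; (3) $(K(X),T_K)$ is weakly mixing; (4) for every $\lambda\in(0,1]$, $(\mathbb{F}^{=\lambda}(X),T_F|_{\mathbb{F}^{=\lambda}(X)})$ is transitive; (5) for every $\lambda\in(0,1]$, $(\mathbb{F}^{=\lambda}(X),T_F|_{\mathbb{F}^{=\lambda}(X)})$ is weakly mixing.
   Context: A dynamical system $(X,T)$ consists of a nontrivial (more than one point) compact metric space $X$ with metric $d$ and a continuous surjection $T:X\to X$. $I=[0,1]$, $\mathbb{Z}^+=\{0,1,2,\dots\}$. Hyperspace: $K(X)$ is the set of all nonempty closed subsets of $X$ with the Hausdorff metric $d_H(A,B)=\max\{\max_{x\in A}\min_{y\in B}d(x,y),\max_{y\in B}\min_{x\in A}d(x,y)\}$, and $T_K:K(X)\to K(X)$ is $T_K(A)=T(A)$. Extend $d_H$ to the empty set by $d_H(\emptyset,\emptyset)=0$ and $d_H(\emptyset,A)=d_H(A,\emptyset)=\mathrm{diam}(X)$ for $A\in K(X)$. Fuzzy sets: $\mathbb{F}(X)$ is the set of all upper semicontinuous functions $A:X\to I$. For $\alpha\in I$, $[A]_\alpha=\{x\in X:A(x)\ge\alpha\}$. The levelwise metric on $\mathbb{F}(X)$ is $d_\infty(A,B)=\sup\{d_H([A]_\alpha,[B]_\alpha):\alpha\in(0,1]\}$. For $\lambda\in(0,1]$, $\mathbb{F}^{=\lambda}(X)=\{A\in\mathbb{F}(X):\max_{x\in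 X}A(x)=\lambda\}$, with the metric $d_\infty$. Zadeh's extension $T_F:\mathbb{F}(X)\to\mathbb{F}(X)$ is $T_F(A)(x)=\sup\{A(y):y\in T^{-1}(x)\}$. For a continuous self-map $S$ of a metric space $Y$: $(Y,S)$ is transitive if for all nonempty open $U,V\subset Y$ there is $n\in\mathbb{Z}^+$ with $S^n(U)\cap V\ne\emptyset$; it is weakly mixing if $(Y\times Y,S\times S)$ is transitive. *)

theory Defs
  imports "HOL-Analysis.Analysis"
begin

section \<open>Topological dynamics\<close>

text \<open>Dynamics are phrased for abstract topologies, so that they apply both to a whole type and to
  a carrier set with a metric of its own. Only the values of \<open>S\<close> on \<open>topspace Y\<close>, which is meant
  to be invariant, matter.\<close>

definition top_transitive :: "'b topology \<Rightarrow> ('b \<Rightarrow> 'b) \<Rightarrow> bool" where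
  "top_transitive Y S \<longleftrightarrow>
     (\<forall>U V. openin Y U \<and> U \<noteq> {} \<and> openin Y V \<and> V \<noteq> {} \<longrightarrow>
        (\<exists>n::nat. (S ^^ n) ` U \<inter> V \<noteq> {}))"

definition weakly_mixing :: "'b topology \<Rightarrow> ('b \<Rightarrow> 'b) \<Rightarrow> bool" where
  "weakly_mixing Y S \<longleftrightarrow> top_transitive (prod_topology Y Y) (map_prod S S)"


section \<open>The hyperspace of nonempty closed sets\<close>

definition hyperspace :: "'a::metric_space set set" where
  "hyperspace = {A. closed A \<and> A \<noteq> {}}"

text \<open>Total on all sets, including the convention for the empty set. On a compact space and for
  nonempty closed sets the suprema and the infima inside \<^const>\<open>infdist\<close> are attained.\<close>

definition hausdorff_dist :: "'a::metric_space set \<Rightarrow> 'a set \<Rightarrow> real" where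
  "hausdorff_dist A B =
     (if A = {} \<and> B = {} then 0
      else if A = {} \<or> B = {} then diameter (UNIV :: 'a set)
      else max (SUP x\<in>A. infdist x B) (SUP y\<in>B. infdist y A))"

definition hyper_topology :: "'a::metric_space set topology" where
  "hyper_topology = Metric_space.mtopology hyperspace hausdorff_dist"

definition hyper_map :: "('a \<Rightarrow> 'a) \<Rightarrow> 'a set \<Rightarrow> 'a set" where
  "hyper_map T A = T ` A"


section \<open>Fuzzy sets\<close>

definition upper_semicontinuous :: "('a::topological_space \<Rightarrow> real) \<Rightarrow> bool" where
  "upper_semicontinuous f \<longleftrightarrow> (\<forall>a. open {x. f x < a})"

definition fuzzy_sets :: "('a::metric_space \<Rightarrow> real) set" where
  "fuzzy_sets = {A. upper_semicontinuous A \<and> range A \<subseteq> {0..1}}"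

definition level :: "('a \<Rightarrow> real) \<Rightarrow> real \<Rightarrow> 'a set" where
  "level A \<alpha> = {x. \<alpha> \<le> A x}"

definition levelwise_dist :: "('a::metric_space \<Rightarrow> real) \<Rightarrow> ('a \<Rightarrow> real) \<Rightarrow> real" where
  "levelwise_dist A B = (SUP \<alpha>\<in>{0<..1}. hausdorff_dist (level A \<alpha>) (level B \<alpha>))"

definition fuzzy_sets_height :: "real \<Rightarrow> ('a::metric_space \<Rightarrow> real) set" where
  "fuzzy_sets_height \<mu> = {A \<in> fuzzy_sets. (\<exists>x. A x = \<mu>) \<and> (\<forall>x. A x \<le> \<mu>)}"

definition fuzzy_topology :: "real \<Rightarrow> ('a::metric_space \<Rightarrow> real) topology" where
  "fuzzy_topology \<mu> = Metric_space.mtopology (fuzzy_sets_height \<mu>) levelwise_dist"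

definition zadeh :: "('a \<Rightarrow> 'a) \<Rightarrow> ('a \<Rightarrow> real) \<Rightarrow> 'a \<Rightarrow> real" where
  "zadeh T A x = (SUP y\<in>T -` {x}. A y)"


section \<open>The two distances are metrics\<close>

context
  assumes compact_UNIV: "compact (UNIV :: 'a::metric_space set)"
begin

lemma dist_le_diameter_UNIV: "dist (x :: 'a) y \<le> diameter (UNIV :: 'a set)"
  using compact_UNIV by (simp add: compact_imp_bounded diameter_bounded_bound)

lemma diameter_UNIV_nonneg: "0 \<le> diameter (UNIV :: 'a set)"
  using compact_UNIV by (simp add: compact_imp_bounded diameter_ge_0)

lemma infdist_le_diameter_UNIV: "infdist (x :: 'a) B \<le> diameter (UNIV :: 'a set)"
proof (cases "B = {}")
  case True
  then show ?thesis by (simp add: infdist_def diameter_UNIV_nonneg)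
next
  case False
  then obtain b where "b \<in> B" by blast
  then show ?thesis
    using infdist_le2 dist_le_diameter_UNIV by blast
qed

lemma hausdorff_dist_le_iff:
  fixes A B :: "'a set"
  assumes "A \<noteq> {}" "B \<noteq> {}"
  shows "hausdorff_dist A B \<le> e \<longleftrightarrow> (\<forall>x\<in>A. infdist x B \<le> e) \<and> (\<forall>y\<in>B. infdist y A \<le> e)"
proof -
  have bdd: "bdd_above ((\<lambda>x. infdist x D) ` C)" for C D :: "'a set"
    by (rule bdd_aboveI2) (rule infdist_le_diameter_UNIV)
  show ?thesis
    using assms by (simp add: hausdorff_dist_def cSUP_le_iff[OF _ bdd])
qed

lemma hausdorff_dist_commute: "hausdorff_dist A B = hausdorff_dist B (A :: 'a set)"
  by (auto simp: hausdorff_dist_def max.commute)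

lemma infdist_le_hausdorff_dist:
  fixes A B :: "'a set"
  assumes "x \<in> A" "B \<noteq> {}"
  shows "infdist x B \<le> hausdorff_dist A B"
  using hausdorff_dist_le_iff[of A B "hausdorff_dist A B"] assms by blast

lemma hausdorff_dist_nonneg: "0 \<le> hausdorff_dist A (B :: 'a set)"
proof (cases "A = {} \<or> B = {}")
  case True
  then show ?thesis by (auto simp: hausdorff_dist_def diameter_UNIV_nonneg)
next
  case False
  then obtain x where "x \<in> A" by blast
  then show ?thesis
    using False infdist_le_hausdorff_dist[of x A B] infdist_nonneg[of x B] by auto
qed

lemma hausdorff_dist_le_diameter: "hausdorff_dist A (B :: 'a set) \<le> diameter (UNIV :: 'a set)"
proof (cases "A = {} \<or> B = {}")
  case True
  then show ?thesis by (auto simp: hausdorff_dist_def diameter_UNIV_nonneg)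
next
  case False
  then show ?thesis by (simp add: hausdorff_dist_le_iff infdist_le_diameter_UNIV)
qed

lemma hausdorff_dist_refl: "hausdorff_dist A (A :: 'a set) = 0"
proof (cases "A = {}")
  case False
  then have "hausdorff_dist A A \<le> 0" by (simp add: hausdorff_dist_le_iff)
  then show ?thesis using hausdorff_dist_nonneg[of A A] by simp
qed (simp add: hausdorff_dist_def)

lemma infdist_hausdorff_triangle:
  fixes B C :: "'a set"
  assumes "B \<noteq> {}" "C \<noteq> {}"
  shows "infdist x C \<le> infdist x B + hausdorff_dist B C"
proof -
  have "infdist x C - hausdorff_dist B C \<le> dist x b" if "b \<in> B" for b
    using infdist_triangle[of x C b] infdist_le_hausdorff_dist[OF that assms(2)] by simp
  then have "infdist x C - hausdorff_dist B C \<le> infdist x B"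
    unfolding infdist_notempty[OF assms(1)] by (intro cINF_greatest assms)
  then show ?thesis by simp
qed

lemma hausdorff_dist_triangle:
  fixes A B C :: "'a set"
  shows "hausdorff_dist A C \<le> hausdorff_dist A B + hausdorff_dist B C"
proof (cases "A = {} \<or> B = {} \<or> C = {}")
  case True
  consider "A = {}" "B = {}" | "B = {}" "C = {}" | "A = {}" "C = {}"
    | "A = {}" "B \<noteq> {}" "C \<noteq> {}" | "C = {}" "A \<noteq> {}" "B \<noteq> {}" | "B = {}" "A \<noteq> {}" "C \<noteq> {}"
    using True by blast
  then show ?thesis
  proof cases
    case 3
    then show ?thesis
      using hausdorff_dist_nonneg[of A B] hausdorff_dist_nonneg[of B C] hausdorff_dist_refl by simp
  next
    case 4
    then show ?thesis using hausdorff_dist_nonneg[of B C] by (simp add: hausdorff_dist_def[of "{}"])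
  next
    case 5
    then show ?thesis using hausdorff_dist_nonneg[of A B]
      by (simp add: hausdorff_dist_def[of _ "{}"])
  next
    case 6
    then show ?thesis
      using hausdorff_dist_le_diameter[of A C] diameter_UNIV_nonneg
      by (simp add: hausdorff_dist_def[of "{}"] hausdorff_dist_def[of _ "{}"])
  qed (auto simp: hausdorff_dist_refl)
next
  case False
  have "infdist x C \<le> hausdorff_dist A B + hausdorff_dist B C" if "x \<in> A" for x
    using infdist_hausdorff_triangle[of B C x] infdist_le_hausdorff_dist[OF that, of B] False
    by simp
  moreover have "infdist z A \<le> hausdorff_dist A B + hausdorff_dist B C" if "z \<in> C" for z
    using infdist_hausdorff_triangle[of B A z] infdist_le_hausdorff_dist[OF that, of B] False
    by (simp add: hausdorff_dist_commute)
  ultimately show ?thesis using False by (simp add: hausdorff_dist_le_iff)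
qed

lemma hausdorff_dist_eq_0_imp:
  fixes A B :: "'a set"
  assumes "\<exists>x y :: 'a. x \<noteq> y" "closed A" "closed B" "hausdorff_dist A B = 0"
  shows "A = B"
proof -
  obtain x y :: 'a where "x \<noteq> y" using assms(1) by blast
  then have "0 < diameter (UNIV :: 'a set)"
    using dist_le_diameter_UNIV[of x y] by (smt (verit) zero_less_dist_iff)
  then consider "A = {}" "B = {}" | "A \<noteq> {}" "B \<noteq> {}"
    using assms(4) unfolding hausdorff_dist_def by (auto split: if_splits)
  then show ?thesis
  proof cases
    case 2
    have "x \<in> B" if "x \<in> A" for x
      using infdist_le_hausdorff_dist[OF that, of B] 2 assms infdist_nonneg[of x B]
      by (simp add: in_closed_iff_infdist_zero)
    moreover have "x \<in> A" if "x \<in> B" for x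
      using infdist_le_hausdorff_dist[OF that, of A] 2 assms infdist_nonneg[of x A]
      by (simp add: in_closed_iff_infdist_zero hausdorff_dist_commute)
    ultimately show ?thesis by blast
  qed simp
qed

lemma Metric_space_hyperspace:
  assumes "\<exists>x y :: 'a. x \<noteq> y"
  shows "Metric_space (hyperspace :: 'a set set) hausdorff_dist"
proof
  show "hausdorff_dist A B = 0 \<longleftrightarrow> A = B" if "A \<in> hyperspace" "B \<in> hyperspace" for A B :: "'a set"
    using that assms hausdorff_dist_eq_0_imp hausdorff_dist_refl by (auto simp: hyperspace_def)
qed (simp_all add: hausdorff_dist_nonneg hausdorff_dist_triangle, rule hausdorff_dist_commute)

lemma closed_level: "upper_semicontinuous A \<Longrightarrow> closed (level A \<alpha>)"
  unfolding upper_semicontinuous_def level_def closed_def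
  by (simp add: Compl_eq not_le)

lemma bdd_above_levelwise:
  fixes A B :: "'a \<Rightarrow> real"
  shows "bdd_above ((\<lambda>\<alpha>. hausdorff_dist (level A \<alpha>) (level B \<alpha>)) ` {0<..1})"
  by (rule bdd_aboveI2) (rule hausdorff_dist_le_diameter)

lemma levelwise_dist_le_iff:
  fixes A B :: "'a \<Rightarrow> real"
  shows "levelwise_dist A B \<le> e \<longleftrightarrow> (\<forall>\<alpha>\<in>{0<..1}. hausdorff_dist (level A \<alpha>) (level B \<alpha>) \<le> e)"
  unfolding levelwise_dist_def by (rule cSUP_le_iff[OF _ bdd_above_levelwise]) auto

lemma hausdorff_dist_le_levelwise_dist:
  fixes A B :: "'a \<Rightarrow> real"
  assumes "\<alpha> \<in> {0<..1}"
  shows "hausdorff_dist (level A \<alpha>) (level B \<alpha>) \<le> levelwise_dist A B"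
  using levelwise_dist_le_iff assms by blast

lemma Metric_space_fuzzy_sets:
  assumes "\<exists>x y :: 'a. x \<noteq> y"
  shows "Metric_space (fuzzy_sets :: ('a \<Rightarrow> real) set) levelwise_dist"
proof
  fix A B C :: "'a \<Rightarrow> real"
  have one: "(1::real) \<in> {0<..1}" by simp
  show nonneg: "0 \<le> levelwise_dist A B"
    using hausdorff_dist_le_levelwise_dist[OF one, of A B] hausdorff_dist_nonneg
    by (rule order_trans[rotated])
  show "levelwise_dist A B = levelwise_dist B A"
    unfolding levelwise_dist_def by (subst hausdorff_dist_commute) (rule refl)
  show "levelwise_dist A C \<le> levelwise_dist A B + levelwise_dist B C"
    unfolding levelwise_dist_le_iff
  proof
    fix \<alpha> :: real
    assume \<alpha>: "\<alpha> \<in> {0<..1}"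
    show "hausdorff_dist (level A \<alpha>) (level C \<alpha>) \<le> levelwise_dist A B + levelwise_dist B C"
      using hausdorff_dist_triangle[of "level A \<alpha>" "level C \<alpha>" "level B \<alpha>"]
        hausdorff_dist_le_levelwise_dist[OF \<alpha>, of A B]
        hausdorff_dist_le_levelwise_dist[OF \<alpha>, of B C] by simp
  qed
  assume A: "A \<in> fuzzy_sets" and B: "B \<in> fuzzy_sets"
  show "levelwise_dist A B = 0 \<longleftrightarrow> A = B"
  proof
    assume "A = B"
    then have "levelwise_dist A B \<le> 0" by (simp add: levelwise_dist_le_iff hausdorff_dist_refl)
    then show "levelwise_dist A B = 0" using nonneg by simp
  next
    assume 0: "levelwise_dist A B = 0"
    have lev: "level A \<alpha> = level B \<alpha>" if "\<alpha> \<in> {0<..1}" for \<alpha>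
    proof (rule hausdorff_dist_eq_0_imp[OF assms])
      show "hausdorff_dist (level A \<alpha>) (level B \<alpha>) = 0"
        using hausdorff_dist_le_levelwise_dist[OF that, of A B] 0
          hausdorff_dist_nonneg[of "level A \<alpha>" "level B \<alpha>"] by simp
    qed (use A B in \<open>auto simp: fuzzy_sets_def closed_level\<close>)
    have range: "0 \<le> A x" "A x \<le> 1" "0 \<le> B x" "B x \<le> 1" for x
      using A B by (auto simp: fuzzy_sets_def image_subset_iff)
    show "A = B"
    proof
      fix x
      have "A x \<le> B x"
        using lev[of "A x"] range[of x] by (cases "A x = 0") (auto simp: level_def set_eq_iff)
      moreover have "B x \<le> A x"
        using lev[of "B x"] range[of x] by (cases "B x = 0") (auto simp: level_def set_eq_iff)
      ultimately show "A x = B x" by simp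
    qed
  qed
qed

lemma Metric_space_fuzzy_sets_height:
  assumes "\<exists>x y :: 'a. x \<noteq> y"
  shows "Metric_space (fuzzy_sets_height \<mu> :: ('a \<Rightarrow> real) set) levelwise_dist"
  by (rule Metric_space.subspace[OF Metric_space_fuzzy_sets[OF assms]])
    (auto simp: fuzzy_sets_height_def)


section \<open>The induced maps are self-maps\<close>

lemma hyper_map_in_hyperspace:
  fixes T :: "'a \<Rightarrow> 'a"
  assumes "continuous_on UNIV T" "A \<in> hyperspace"
  shows "hyper_map T A \<in> hyperspace"
proof -
  have "compact A"
    using assms(2) compact_UNIV compact_Int_closed[of UNIV A] by (simp add: hyperspace_def)
  then have "compact (T ` A)"
    using compact_continuous_image[OF continuous_on_subset[OF assms(1) subset_UNIV]] by simp
  then show ?thesis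
    using assms(2) by (simp add: hyperspace_def hyper_map_def compact_imp_closed)
qed

lemma upper_semicontinuous_attains_sup:
  fixes A :: "'a \<Rightarrow> real"
  assumes "upper_semicontinuous A" "closed S" "S \<noteq> {}"
  shows "\<exists>x\<in>S. \<forall>y\<in>S. A y \<le> A x"
proof (rule ccontr)
  assume "\<not> ?thesis"
  then have cover: "S \<subseteq> (\<Union>y\<in>S. {x. A x < A y})" by (force simp: not_le)
  have "compact S" using compact_UNIV compact_Int_closed[of UNIV S] assms(2) by simp
  then obtain F where F: "F \<subseteq> S" "finite F" "S \<subseteq> (\<Union>y\<in>F. {x. A x < A y})"
    using compactE_image[OF _ _ cover] assms(1) unfolding upper_semicontinuous_def by metis
  then have "F \<noteq> {}" using assms(3) by auto
  then obtain m where m: "m \<in> F" "A m = Max (A ` F)"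
    using F(2) Max_in[of "A ` F"] by fastforce
  then obtain y where "y \<in> F" "A m < A y" using F by auto
  then show False using m F(2) by (metis Max_ge finite_imageI image_eqI not_le)
qed

lemma zadeh_attained:
  fixes T :: "'a \<Rightarrow> 'a"
  assumes "continuous_on UNIV T" "surj T" "upper_semicontinuous A"
  shows "\<exists>y. T y = x \<and> A y = zadeh T A x \<and> (\<forall>z. T z = x \<longrightarrow> A z \<le> A y)"
proof -
  have "closed (T -` {x})" using assms(1) by (simp add: closed_vimage)
  moreover have "T -` {x} \<noteq> {}" using assms(2) by (metis empty_iff surjD vimage_singleton_eq)
  ultimately obtain y where y: "y \<in> T -` {x}" "\<forall>z\<in>T -` {x}. A z \<le> A y"
    using upper_semicontinuous_attains_sup[OF assms(3)] by meson
  have "zadeh T A x = A y"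
    unfolding zadeh_def using y by (intro cSup_eq_maximum) auto
  then show ?thesis using y by auto
qed

lemma level_zadeh:
  fixes T :: "'a \<Rightarrow> 'a"
  assumes "continuous_on UNIV T" "surj T" "upper_semicontinuous A"
  shows "level (zadeh T A) \<alpha> = T ` level A \<alpha>"
proof (intro equalityI subsetI)
  fix x assume "x \<in> level (zadeh T A) \<alpha>"
  then show "x \<in> T ` level A \<alpha>"
    using zadeh_attained[OF assms, of x] by (force simp: level_def)
next
  fix x assume "x \<in> T ` level A \<alpha>"
  then show "x \<in> level (zadeh T A) \<alpha>"
    using zadeh_attained[OF assms, of x] by (force simp: level_def)
qed

lemma zadeh_in_fuzzy_sets_height:
  fixes T :: "'a \<Rightarrow> 'a"
  assumes T: "continuous_on UNIV T" "surj T" and A: "A \<in> fuzzy_sets_height \<mu>"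
  shows "zadeh T A \<in> fuzzy_sets_height \<mu>"
proof -
  have usc: "upper_semicontinuous A" and range: "range A \<subseteq> {0..1}" and
    max: "\<exists>x. A x = \<mu>" "\<forall>x. A x \<le> \<mu>"
    using A by (auto simp: fuzzy_sets_height_def fuzzy_sets_def)
  have att: "\<exists>y. T y = x \<and> A y = zadeh T A x \<and> (\<forall>z. T z = x \<longrightarrow> A z \<le> A y)" for x
    by (rule zadeh_attained[OF T usc])
  have "open {x. zadeh T A x < a}" for a
  proof -
    have "compact (level A a)"
      using compact_UNIV compact_Int_closed[of UNIV "level A a"] closed_level[OF usc] by simp
    then have "closed (T ` level A a)"
      using compact_continuous_image[OF continuous_on_subset[OF T(1) subset_UNIV]]
      by (simp add: compact_imp_closed)
    moreover have "{x. zadeh T A x < a} = - level (zadeh T A) a" by (auto simp: level_def)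
    ultimately show ?thesis by (simp add: level_zadeh[OF T usc] open_Compl)
  qed
  moreover have "range (zadeh T A) \<subseteq> {0..1}"
  proof
    fix r assume "r \<in> range (zadeh T A)"
    then obtain x where "r = zadeh T A x" by blast
    then obtain y where "A y = r" using att[of x] by auto
    then show "r \<in> {0..1}" using range by blast
  qed
  moreover have le: "zadeh T A x \<le> \<mu>" for x
    using att[of x] max(2) by metis
  moreover have "\<exists>x. zadeh T A x = \<mu>"
  proof -
    obtain y where y: "A y = \<mu>" using max(1) by blast
    then have "\<mu> \<le> zadeh T A (T y)" using att[of "T y"] by metis
    then show ?thesis using le[of "T y"] order_antisym by blast
  qed
  ultimately show ?thesis
    by (simp add: fuzzy_sets_height_def fuzzy_sets_def upper_semicontinuous_def)
qed

end

end

theory Submission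
  imports Defs
begin

text \<open>
  Weak mixing lets one time \<open>n\<close> serve finitely many pairs of open sets at once (Furstenberg). Apply
  this to all pairs of balls around a finite \<open>e\<close>-net \<open>F\<close>: there are \<open>n\<close> and points \<open>u i j\<close> that
  start near \<open>i\<close> and are sent near \<open>j\<close> by \<open>T ^^ n\<close>. The points \<open>u i j\<close> with \<open>i\<close> near a set \<open>P\<close>
  and \<open>j\<close> near a set \<open>Q\<close> form a finite set that is close to \<open>P\<close> and whose \<open>n\<close>-th image is close to
  \<open>Q\<close>. Giving \<open>u i j\<close> the smaller of the suprema of \<open>A\<close> near \<open>i\<close> and of \<open>B\<close> near \<open>j\<close> does the same
  on all levels of two fuzzy sets simultaneously. Since \<open>n\<close> depends on \<open>e\<close> only, the induced systems
  are weakly mixing. Conversely, a set near \<open>{x}\<close> whose \<open>n\<close>-th image is near \<open>{y, z}\<close> shows that a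
  neighbourhood of \<open>x\<close> meets neighbourhoods of \<open>y\<close> and \<open>z\<close> at the same time \<open>n\<close>, and this already
  implies weak mixing.
\<close>

section \<open>Weak mixing and hitting times\<close>

text \<open>The set usually written \<open>N(U, V)\<close>. With it weak mixing becomes a statement
  about intersections of sets of times, and the product space disappears.\<close>

definition hitting_times :: "('b \<Rightarrow> 'b) \<Rightarrow> 'b set \<Rightarrow> 'b set \<Rightarrow> nat set" where
  "hitting_times S U V = {n. (S ^^ n) ` U \<inter> V \<noteq> {}}"

lemma hitting_times_iff: "n \<in> hitting_times S U V \<longleftrightarrow> (\<exists>x\<in>U. (S ^^ n) x \<in> V)"
  by (auto simp: hitting_times_def)

lemma map_prod_funpow:
  fixes f :: "'a \<Rightarrow> 'a" and g :: "'b \<Rightarrow> 'b"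
  shows "map_prod f g ^^ n = map_prod (f ^^ n) (g ^^ n)"
  by (induction n) (auto simp: fun_eq_iff)

lemma top_transitiveD:
  "\<lbrakk>top_transitive Y S; openin Y U; U \<noteq> {}; openin Y V; V \<noteq> {}\<rbrakk> \<Longrightarrow> hitting_times S U V \<noteq> {}"
  by (simp add: top_transitive_def hitting_times_def)

text \<open>Every nonempty open set of the product contains a nonempty open box, so transitivity of
  the product map need only be tested on boxes; a time joins two boxes iff it joins both pairs of
  factors.\<close>

lemma weakly_mixing_iff_hitting_times:
  "weakly_mixing Y S \<longleftrightarrow>
    (\<forall>U U' V V'. openin Y U \<and> U \<noteq> {} \<and> openin Y U' \<and> U' \<noteq> {} \<and>
        openin Y V \<and> V \<noteq> {} \<and> openin Y V' \<and> V' \<noteq> {} \<longrightarrow>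
      hitting_times S U V \<inter> hitting_times S U' V' \<noteq> {})" (is "?L \<longleftrightarrow> ?R")
proof
  assume L: ?L
  show ?R
  proof (intro allI impI, elim conjE)
    fix U U' V V'
    assume *: "openin Y U" "U \<noteq> {}" "openin Y U'" "U' \<noteq> {}"
      "openin Y V" "V \<noteq> {}" "openin Y V'" "V' \<noteq> {}"
    then have "openin (prod_topology Y Y) (U \<times> U')" "U \<times> U' \<noteq> {}"
      "openin (prod_topology Y Y) (V \<times> V')" "V \<times> V' \<noteq> {}"
      by (auto simp: openin_prod_Times_iff)
    then have "hitting_times (map_prod S S) (U \<times> U') (V \<times> V') \<noteq> {}"
      by (rule top_transitiveD[OF L[unfolded weakly_mixing_def]])
    then obtain n where "n \<in> hitting_times (map_prod S S) (U \<times> U') (V \<times> V')" by blast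
    then have "n \<in> hitting_times S U V \<inter> hitting_times S U' V'"
      by (auto simp: map_prod_funpow hitting_times_iff)
    then show "hitting_times S U V \<inter> hitting_times S U' V' \<noteq> {}" by blast
  qed
next
  assume R: ?R
  show ?L
    unfolding weakly_mixing_def top_transitive_def
  proof (intro allI impI, elim conjE)
    fix W Z
    assume W: "openin (prod_topology Y Y) W" "W \<noteq> {}" and Z: "openin (prod_topology Y Y) Z" "Z \<noteq> {}"
    have box: "\<exists>U U'. openin Y U \<and> openin Y U' \<and> U \<noteq> {} \<and> U' \<noteq> {} \<and> U \<times> U' \<subseteq> W"
      if op: "openin (prod_topology Y Y) W" and ne: "W \<noteq> {}" for W
    proof -
      obtain a b where "(a, b) \<in> W" using ne by auto
      then obtain U U' where "openin Y U" "openin Y U'" "a \<in> U" "b \<in> U'" "U \<times> U' \<subseteq> W"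
        using op unfolding openin_prod_topology_alt by meson
      then show ?thesis by blast
    qed
    obtain U U' where U: "openin Y U" "openin Y U'" "U \<noteq> {}" "U' \<noteq> {}" "U \<times> U' \<subseteq> W"
      using box[OF W] by blast
    obtain V V' where V: "openin Y V" "openin Y V'" "V \<noteq> {}" "V' \<noteq> {}" "V \<times> V' \<subseteq> Z"
      using box[OF Z] by blast
    obtain n where "n \<in> hitting_times S U V" "n \<in> hitting_times S U' V'"
      using R[rule_format, of U U' V V'] U V by blast
    then obtain x x' where "(x, x') \<in> W" "((S ^^ n) x, (S ^^ n) x') \<in> Z"
      using U(5) V(5) unfolding hitting_times_iff by blast
    then have "((S ^^ n) x, (S ^^ n) x') \<in> (map_prod S S ^^ n) ` W \<inter> Z"
      by (auto simp: map_prod_funpow intro!: image_eqI[of _ _ "(x, x')"])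
    then show "\<exists>n. (map_prod S S ^^ n) ` W \<inter> Z \<noteq> {}" by blast
  qed
qed

lemma weakly_mixing_hitting_times:
  "\<lbrakk>weakly_mixing Y S; openin Y U; U \<noteq> {}; openin Y U'; U' \<noteq> {};
    openin Y V; V \<noteq> {}; openin Y V'; V' \<noteq> {}\<rbrakk> \<Longrightarrow>
    hitting_times S U V \<inter> hitting_times S U' V' \<noteq> {}"
  by (simp add: weakly_mixing_iff_hitting_times)

lemma weakly_mixing_imp_top_transitive:
  assumes "weakly_mixing Y S"
  shows "top_transitive Y S"
  unfolding top_transitive_def
proof (intro allI impI, elim conjE)
  fix U V assume "openin Y U" "U \<noteq> {}" "openin Y V" "V \<noteq> {}"
  then have "hitting_times S U V \<inter> hitting_times S U V \<noteq> {}"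
    by (intro weakly_mixing_hitting_times[OF assms])
  then show "\<exists>n. (S ^^ n) ` U \<inter> V \<noteq> {}" unfolding hitting_times_def by blast
qed

section \<open>Intersections of hitting time sets for a continuous map\<close>

lemma open_vimage_funpow:
  fixes T :: "'a::topological_space \<Rightarrow> 'a"
  assumes "continuous_on UNIV T" "open U"
  shows "open ((T ^^ n) -` U)"
proof (induction n)
  case (Suc n)
  have "(T ^^ Suc n) -` U = T -` ((T ^^ n) -` U)" by (simp only: funpow_Suc_right vimage_comp)
  then show ?case using open_vimage[OF Suc assms(1)] by (simp only:)
qed (simp add: assms(2))

lemma funpow_commute:
  fixes f :: "'a \<Rightarrow> 'a"
  shows "(f ^^ m) ((f ^^ n) x) = (f ^^ n) ((f ^^ m) x)"
  by (metis add.commute comp_apply funpow_add)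

text \<open>Iterates of \<open>T\<close> commute: if \<open>x\<close> witnesses the left-hand side
  at time \<open>k\<close>, then \<open>x\<close> serves the first pair and
  \<open>(T ^^ n) x\<close> the second.\<close>

lemma hitting_times_pullback_subset:
  "hitting_times T (U \<inter> (T ^^ n) -` U') (V \<inter> (T ^^ n) -` V') \<subseteq>
    hitting_times T U V \<inter> hitting_times T U' V'"
proof
  fix k assume "k \<in> hitting_times T (U \<inter> (T ^^ n) -` U') (V \<inter> (T ^^ n) -` V')"
  then obtain x where x: "x \<in> U" "(T ^^ n) x \<in> U'" "(T ^^ k) x \<in> V" "(T ^^ n) ((T ^^ k) x) \<in> V'"
    by (auto simp: hitting_times_iff)
  have "(T ^^ k) ((T ^^ n) x) \<in> V'" using x(4) by (subst funpow_commute)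
  then show "k \<in> hitting_times T U V \<inter> hitting_times T U' V'"
    unfolding Int_iff hitting_times_iff using x(1-3) by (intro conjI bexI)
qed

text \<open>By induction on \<open>I\<close>, all pairs are merged into a single pair
  \<open>A\<close>, \<open>B\<close> whose hitting times serve every pair at once.\<close>

lemma weakly_mixing_hitting_times_Inter:
  fixes T :: "'a::topological_space \<Rightarrow> 'a"
  assumes wm: "weakly_mixing euclidean T" and T: "continuous_on UNIV T"
    and I: "finite I"
    and UV: "\<And>i. i \<in> I \<Longrightarrow> open (U i) \<and> U i \<noteq> {} \<and> open (V i) \<and> V i \<noteq> {}"
  shows "\<exists>n. \<forall>i\<in>I. n \<in> hitting_times T (U i) (V i)"
proof -
  have wm2: "hitting_times T A B \<inter> hitting_times T A' B' \<noteq> {}"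
    if "open A" "A \<noteq> {}" "open A'" "A' \<noteq> {}" "open B" "B \<noteq> {}" "open B'" "B' \<noteq> {}" for A A' B B'
    using that by (intro weakly_mixing_hitting_times[OF wm]) (simp_all add: open_openin[symmetric])
  have "\<exists>A B. open A \<and> A \<noteq> {} \<and> open B \<and> B \<noteq> {} \<and>
      (\<forall>i\<in>I. hitting_times T A B \<subseteq> hitting_times T (U i) (V i))"
    using I UV
  proof (induction I)
    case empty
    have "(UNIV :: 'a set) \<noteq> {}" by simp
    then show ?case by blast
  next
    case (insert i I)
    then obtain A B where AB: "open A" "A \<noteq> {}" "open B" "B \<noteq> {}"
      "\<forall>i\<in>I. hitting_times T A B \<subseteq> hitting_times T (U i) (V i)" by auto
    have Ui: "open (U i)" "U i \<noteq> {}" "open (V i)" "V i \<noteq> {}" using insert.prems by auto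
    \<comment> \<open>Weak mixing is applied crosswise, joining \<open>A\<close> to
      \<open>U i\<close> and \<open>B\<close> to \<open>V i\<close>. This is exactly what keeps the
      two intersections with preimages under \<open>T ^^ n\<close> nonempty.\<close>
    obtain n where n: "n \<in> hitting_times T A (U i)" "n \<in> hitting_times T B (V i)"
      using wm2[of A B "U i" "V i"] AB Ui by blast
    let ?A = "A \<inter> (T ^^ n) -` U i" and ?B = "B \<inter> (T ^^ n) -` V i"
    have "open ?A" "open ?B" using AB Ui open_vimage_funpow[OF T] by auto
    moreover have "?A \<noteq> {}" "?B \<noteq> {}" using n by (auto simp: hitting_times_iff)
    moreover have "\<forall>j\<in>insert i I. hitting_times T ?A ?B \<subseteq> hitting_times T (U j) (V j)"
      using AB(5) hitting_times_pullback_subset[of T A n "U i" B "V i"] by blast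
    ultimately show ?case by blast
  qed
  then obtain A B where AB: "open A" "A \<noteq> {}" "open B" "B \<noteq> {}"
    "\<forall>i\<in>I. hitting_times T A B \<subseteq> hitting_times T (U i) (V i)" by blast
  obtain n where "n \<in> hitting_times T A B" using wm2[of A A B B] AB by blast
  then show ?thesis using AB(5) by blast
qed

text \<open>Some time \<open>n\<close> takes part of \<open>U\<close> into \<open>U'\<close>. From
  that part, one time \<open>k\<close> reaches both \<open>V\<close> and the preimage of
  \<open>V'\<close> under \<open>T ^^ n\<close>. As iterates commute, \<open>k\<close> also takes
  \<open>U'\<close> to \<open>V'\<close>. Surjectivity makes the preimage nonempty.\<close>

lemma weakly_mixing_if_common_source:
  fixes T :: "'a::topological_space \<Rightarrow> 'a"
  assumes T: "continuous_on UNIV T" "surj T"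
    and hit: "\<And>U V W. \<lbrakk>open U; U \<noteq> {}; open V; V \<noteq> {}; open W; W \<noteq> {}\<rbrakk> \<Longrightarrow>
      hitting_times T U V \<inter> hitting_times T U W \<noteq> {}"
  shows "weakly_mixing euclidean T"
  unfolding weakly_mixing_iff_hitting_times open_openin[symmetric]
proof (intro allI impI, elim conjE)
  fix U U' V V' :: "'a set"
  assume *: "open U" "U \<noteq> {}" "open U'" "U' \<noteq> {}" "open V" "V \<noteq> {}" "open V'" "V' \<noteq> {}"
  \<comment> \<open>With equal targets the hypothesis \<open>hit\<close> is plain
    transitivity.\<close>
  obtain n where n: "n \<in> hitting_times T U U'" using hit[OF *(1-4) *(3,4)] by blast
  have "surj (T ^^ n)" using T(2) by (rule surj_fn)
  then have V': "(T ^^ n) -` V' \<noteq> {}" using *(8) by (metis surj_image_vimage_eq image_empty)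
  have op: "open (U \<inter> (T ^^ n) -` U')" "open ((T ^^ n) -` V')"
    using * open_vimage_funpow[OF T(1)] by auto
  have "U \<inter> (T ^^ n) -` U' \<noteq> {}" using n by (auto simp: hitting_times_iff)
  then obtain k where k: "k \<in> hitting_times T (U \<inter> (T ^^ n) -` U') V"
    "k \<in> hitting_times T (U \<inter> (T ^^ n) -` U') ((T ^^ n) -` V')"
    using hit[OF op(1) _ *(5,6) op(2) V'] by blast
  have "k \<in> hitting_times T U V" using k(1) by (auto simp: hitting_times_iff)
  moreover have "k \<in> hitting_times T U' V'"
    using k(2) by (auto simp: hitting_times_iff funpow_commute[of n T k])
  ultimately show "hitting_times T U V \<inter> hitting_times T U' V' \<noteq> {}" by blast
qed

section \<open>Weak mixing and transitivity tested on metric balls\<close>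

context Metric_space
begin

text \<open>The time \<open>n\<close> is chosen before \<open>a\<close> and \<open>b\<close>, so the
  same \<open>n\<close> works for two pairs of balls, once \<open>e\<close> is at most all four
  radii.\<close>

lemma weakly_mixing_if_uniform_hitting:
  assumes hit: "\<And>e. e > 0 \<Longrightarrow>
    \<exists>n. \<forall>a\<in>M. \<forall>b\<in>M. \<exists>c\<in>M. (S ^^ n) c \<in> M \<and> d a c < e \<and> d b ((S ^^ n) c) < e"
  shows "weakly_mixing mtopology S"
  unfolding weakly_mixing_iff_hitting_times
proof (intro allI impI, elim conjE)
  fix U U' V V'
  assume *: "openin mtopology U" "U \<noteq> {}" "openin mtopology U'" "U' \<noteq> {}"
    "openin mtopology V" "V \<noteq> {}" "openin mtopology V'" "V' \<noteq> {}"
  have ball: "\<exists>a\<in>M. \<exists>e>0. mball a e \<subseteq> U" if "openin mtopology U" "U \<noteq> {}" for U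
    using that unfolding openin_mtopology by blast
  obtain a p where ap: "a \<in> M" "p > 0" "mball a p \<subseteq> U" using ball *(1,2) by blast
  obtain a' p' where ap': "a' \<in> M" "p' > 0" "mball a' p' \<subseteq> U'" using ball *(3,4) by blast
  obtain b q where bq: "b \<in> M" "q > 0" "mball b q \<subseteq> V" using ball *(5,6) by blast
  obtain b' q' where bq': "b' \<in> M" "q' > 0" "mball b' q' \<subseteq> V'" using ball *(7,8) by blast
  note ab = ap ap' bq bq'
  define e where "e = min (min p p') (min q q')"
  have e: "e > 0" "e \<le> p" "e \<le> p'" "e \<le> q" "e \<le> q'" using ab by (auto simp: e_def)
  obtain n where n:
    "\<forall>a\<in>M. \<forall>b\<in>M. \<exists>c\<in>M. (S ^^ n) c \<in> M \<and> d a c < e \<and> d b ((S ^^ n) c) < e"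
    using hit[OF e(1)] by blast
  obtain c where c: "c \<in> M" "(S ^^ n) c \<in> M" "d a c < e" "d b ((S ^^ n) c) < e"
    using n ab by blast
  obtain c' where c': "c' \<in> M" "(S ^^ n) c' \<in> M" "d a' c' < e" "d b' ((S ^^ n) c') < e"
    using n ab by blast
  have "c \<in> mball a p" "(S ^^ n) c \<in> mball b q" "c' \<in> mball a' p'" "(S ^^ n) c' \<in> mball b' q'"
    using c c' e ab by auto
  then have "n \<in> hitting_times S U V" "n \<in> hitting_times S U' V'"
    unfolding hitting_times_iff using ab by blast+
  then show "hitting_times S U V \<inter> hitting_times S U' V' \<noteq> {}" by blast
qed

lemma top_transitive_mballs:
  assumes "top_transitive mtopology S" "a \<in> M" "b \<in> M" "e > 0"
  shows "\<exists>n. \<exists>c\<in>M. d a c < e \<and> d b ((S ^^ n) c) < e"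
proof -
  have "openin mtopology (mball a e)" "mball a e \<noteq> {}" "openin mtopology (mball b e)" "mball b e \<noteq> {}"
    using assms by auto
  then have "hitting_times S (mball a e) (mball b e) \<noteq> {}" by (rule top_transitiveD[OF assms(1)])
  then show ?thesis by (auto simp: hitting_times_def)
qed

end


section \<open>Orbit segments joining the points of a net\<close>

text \<open>The height is attained. Hence fuzzy sets of equal height have empty levels for the same
  \<alpha>, and the convention for the distance from an empty to a nonempty set never
  enters.\<close>

lemma level_nonempty_iff:
  assumes "A \<in> fuzzy_sets_height \<mu>"
  shows "level A \<alpha> \<noteq> {} \<longleftrightarrow> \<alpha> \<le> \<mu>"
proof -
  obtain x where "A x = \<mu>" "\<And>y. A y \<le> \<mu>" using assms by (auto simp: fuzzy_sets_height_def)
  then show ?thesis by (auto simp: level_def intro: order_trans)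
qed

text \<open>The data shared by the hyperspace and the fuzzy constructions: one time \<open>n\<close>
  for all pairs of points of a finite net. The bounds are non-strict to match closed balls, on which
  upper semicontinuous functions attain their suprema.\<close>

locale orbit_net =
  fixes T :: "'a::metric_space \<Rightarrow> 'a" and e :: real and n :: nat and F :: "'a set"
    and u :: "'a \<Rightarrow> 'a \<Rightarrow> 'a"
  assumes compact_UNIV: "compact (UNIV :: 'a set)"
    and finite_net: "finite F"
    and net: "\<exists>i\<in>F. dist i x \<le> e"
    and start: "\<lbrakk>i \<in> F; j \<in> F\<rbrakk> \<Longrightarrow> dist i (u i j) \<le> e"
    and finish: "\<lbrakk>i \<in> F; j \<in> F\<rbrakk> \<Longrightarrow> dist j ((T ^^ n) (u i j)) \<le> e"

text \<open>Compactness gives a finite cover by balls of radius \<open>e\<close>; a simultaneous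
  hitting time for all pairs of these balls gives \<open>n\<close> and \<open>u\<close>.\<close>

lemma weakly_mixing_imp_orbit_net:
  fixes T :: "'a::metric_space \<Rightarrow> 'a"
  assumes "compact (UNIV :: 'a set)" "continuous_on UNIV T" "weakly_mixing euclidean T" "e > 0"
  shows "\<exists>n F u. orbit_net T e n F u"
proof -
  obtain F where F: "finite F" "(UNIV :: 'a set) \<subseteq> (\<Union>x\<in>F. ball x e)"
  proof (rule compactE_image[OF assms(1), of UNIV "\<lambda>x. ball x e"])
    show "(UNIV :: 'a set) \<subseteq> (\<Union>x\<in>UNIV. ball x e)"
      using assms(4) by (auto intro: centre_in_ball[THEN iffD2])
  qed auto
  obtain n where n: "\<forall>p\<in>F \<times> F. n \<in> hitting_times T (ball (fst p) e) (ball (snd p) e)"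
    using weakly_mixing_hitting_times_Inter[OF assms(3,2), of "F \<times> F" "\<lambda>p. ball (fst p) e"
        "\<lambda>p. ball (snd p) e"] F(1) assms(4) by auto
  then have "\<forall>i j. \<exists>x. i \<in> F \<and> j \<in> F \<longrightarrow> dist i x < e \<and> dist j ((T ^^ n) x) < e"
    by (fastforce simp: hitting_times_iff)
  then obtain u where u:
    "\<And>i j. i \<in> F \<and> j \<in> F \<longrightarrow> dist i (u i j) < e \<and> dist j ((T ^^ n) (u i j)) < e"
    by metis
  have "\<exists>i\<in>F. dist i x \<le> e" for x
  proof -
    obtain i where "i \<in> F" "x \<in> ball i e" using F(2) by blast
    then show ?thesis by (intro bexI[of _ i]) auto
  qed
  then have "orbit_net T e n F u"
    using assms(1) F(1) u by unfold_locales (auto simp: less_imp_le)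
  then show ?thesis by blast
qed

context orbit_net
begin

text \<open>Every \<open>i\<close> near \<open>P\<close> is paired with every \<open>j\<close> near
  \<open>Q\<close>, which avoids choosing a correspondence between the two sets and makes the
  construction compatible with levels of fuzzy sets.\<close>

definition joining_set :: "'a set \<Rightarrow> 'a set \<Rightarrow> 'a set" where
  "joining_set P Q = {u i j | i j. i \<in> F \<and> j \<in> F \<and> cball i e \<inter> P \<noteq> {} \<and> cball j e \<inter> Q \<noteq> {}}"

lemma finite_joining_set: "finite (joining_set P Q)"
proof -
  have "joining_set P Q \<subseteq> (\<lambda>(i, j). u i j) ` (F \<times> F)" by (auto simp: joining_set_def)
  then show ?thesis by (rule finite_subset) (simp add: finite_net)
qed

lemma joining_set_empty [simp]: "joining_set {} Q = {}" "joining_set P {} = {}"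
  by (auto simp: joining_set_def)

lemma net_near: "x \<in> P \<Longrightarrow> \<exists>i\<in>F. x \<in> cball i e \<and> cball i e \<inter> P \<noteq> {}"
  using net[of x] by force

lemma joining_set_nonempty:
  assumes "P \<noteq> {}" "Q \<noteq> {}"
  shows "joining_set P Q \<noteq> {}"
proof -
  obtain i j where "i \<in> F" "cball i e \<inter> P \<noteq> {}" "j \<in> F" "cball j e \<inter> Q \<noteq> {}"
    using assms net_near by (meson ex_in_conv)
  then show ?thesis unfolding joining_set_def by blast
qed

lemma hausdorff_dist_le_pointwise:
  fixes P Q :: "'a set"
  assumes "P \<noteq> {}" "Q \<noteq> {}"
    and "\<And>x. x \<in> P \<Longrightarrow> \<exists>y\<in>Q. dist x y \<le> r" "\<And>y. y \<in> Q \<Longrightarrow> \<exists>x\<in>P. dist x y \<le> r"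
  shows "hausdorff_dist P Q \<le> r"
  using assms by (metis hausdorff_dist_le_iff[OF compact_UNIV] infdist_le2 dist_commute)

text \<open>One \<open>e\<close> leads from a point of \<open>P\<close> to a net point
  \<open>i\<close>, the other from \<open>i\<close> to \<open>u i j\<close>. That \<open>Q\<close>
  is nonempty supplies a partner \<open>j\<close>.\<close>

lemma hausdorff_dist_joining_set:
  assumes "P \<noteq> {}" "Q \<noteq> {}"
  shows "hausdorff_dist P (joining_set P Q) \<le> 2 * e"
proof (rule hausdorff_dist_le_pointwise[OF assms(1) joining_set_nonempty[OF assms]])
  fix x assume "x \<in> P"
  then obtain i where i: "i \<in> F" "x \<in> cball i e" "cball i e \<inter> P \<noteq> {}" using net_near by blast
  obtain j where j: "j \<in> F" "cball j e \<inter> Q \<noteq> {}" using net_near assms(2) by blast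
  have "u i j \<in> joining_set P Q" using i j by (auto simp: joining_set_def)
  moreover have "dist x (u i j) \<le> 2 * e"
    using start[OF i(1) j(1)] i(2) dist_triangle3[of x "u i j" i] by simp
  ultimately show "\<exists>y\<in>joining_set P Q. dist x y \<le> 2 * e" by blast
next
  fix y assume "y \<in> joining_set P Q"
  then obtain i j where ij: "y = u i j" "i \<in> F" "j \<in> F" and "cball i e \<inter> P \<noteq> {}"
    unfolding joining_set_def by blast
  then obtain x where x: "x \<in> P" "dist i x \<le> e" by auto
  then show "\<exists>x\<in>P. dist x y \<le> 2 * e"
    using start[OF ij(2,3)] dist_triangle3[of x y i] ij(1) by (intro bexI[of _ x]) auto
qed

lemma hausdorff_dist_image_joining_set:
  assumes "P \<noteq> {}" "Q \<noteq> {}"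
  shows "hausdorff_dist Q ((T ^^ n) ` joining_set P Q) \<le> 2 * e"
proof (rule hausdorff_dist_le_pointwise[OF assms(2)])
  show "(T ^^ n) ` joining_set P Q \<noteq> {}" using joining_set_nonempty[OF assms] by simp
next
  fix x assume "x \<in> Q"
  then obtain j where j: "j \<in> F" "x \<in> cball j e" "cball j e \<inter> Q \<noteq> {}" using net_near by blast
  obtain i where i: "i \<in> F" "cball i e \<inter> P \<noteq> {}" using net_near assms(1) by blast
  have "u i j \<in> joining_set P Q" using i j by (auto simp: joining_set_def)
  moreover have "dist x ((T ^^ n) (u i j)) \<le> 2 * e"
    using finish[OF i(1) j(1)] j(2) dist_triangle3[of x "(T ^^ n) (u i j)" j] by simp
  ultimately show "\<exists>y\<in>(T ^^ n) ` joining_set P Q. dist x y \<le> 2 * e" by blast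
next
  fix y assume "y \<in> (T ^^ n) ` joining_set P Q"
  then obtain i j where ij: "y = (T ^^ n) (u i j)" "i \<in> F" "j \<in> F" and "cball j e \<inter> Q \<noteq> {}"
    unfolding joining_set_def by blast
  then obtain x where x: "x \<in> Q" "dist j x \<le> e" by auto
  then show "\<exists>x\<in>Q. dist x y \<le> 2 * e"
    using finish[OF ij(2,3)] dist_triangle3[of x y j] ij(1) by (intro bexI[of _ x]) auto
qed

text \<open>The minimum makes a level require both sides, and the maximum handles points that equal
  \<open>u i j\<close> for several pairs. The inserted 0 is the value at points that are no
  \<open>u i j\<close>.\<close>

definition joining_fuzzy :: "('a \<Rightarrow> real) \<Rightarrow> ('a \<Rightarrow> real) \<Rightarrow> 'a \<Rightarrow> real" where
  "joining_fuzzy A B y = Max (insert 0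
     ((\<lambda>(i, j). min (SUP x\<in>cball i e. A x) (SUP x\<in>cball j e. B x)) ` {(i, j). i \<in> F \<and> j \<in> F \<and> u i j = y}))"

lemma finite_joining_pairs: "finite {(i, j). i \<in> F \<and> j \<in> F \<and> u i j = y}"
  by (rule finite_subset[of _ "F \<times> F"]) (auto simp: finite_net)

lemma le_SUP_cball_iff:
  assumes "upper_semicontinuous A" "i \<in> F"
  shows "\<alpha> \<le> (SUP x\<in>cball i e. A x) \<longleftrightarrow> cball i e \<inter> level A \<alpha> \<noteq> {}"
proof -
  \<comment> \<open>A net point and \<open>start\<close> force \<open>e\<close> to be nonnegative,
    so the closed ball contains its centre and the supremum is over a nonempty compact set.\<close>
  have "e \<ge> 0" using start[OF assms(2,2)] zero_le_dist order_trans by blast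
  then obtain x where x: "x \<in> cball i e" "\<forall>y\<in>cball i e. A y \<le> A x"
    using upper_semicontinuous_attains_sup[OF compact_UNIV assms(1), of "cball i e"] by auto
  have "(SUP x\<in>cball i e. A x) = A x" using x by (intro cSup_eq_maximum) auto
  then show ?thesis using x by (force simp: level_def)
qed

text \<open>A finite maximum reaches \<alpha> iff one of its entries does, and positivity of
  \<alpha> excludes the inserted 0. This reduces distances between fuzzy sets to those between
  joining sets.\<close>

lemma level_joining_fuzzy:
  assumes "upper_semicontinuous A" "upper_semicontinuous B" "\<alpha> > 0"
  shows "level (joining_fuzzy A B) \<alpha> = joining_set (level A \<alpha>) (level B \<alpha>)"
proof -
  have "\<alpha> \<le> joining_fuzzy A B y \<longleftrightarrow> (\<exists>i\<in>F. \<exists>j\<in>F. u i j = y \<and>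
      \<alpha> \<le> (SUP x\<in>cball i e. A x) \<and> \<alpha> \<le> (SUP x\<in>cball j e. B x))" for y
    using assms(3) unfolding joining_fuzzy_def by (subst Max_ge_iff) (auto simp: finite_joining_pairs)
  then show ?thesis
    using assms(1,2) by (auto simp: level_def[of "joining_fuzzy A B"] joining_set_def le_SUP_cball_iff)
qed

lemma joining_fuzzy_nonneg: "0 \<le> joining_fuzzy A B y"
  unfolding joining_fuzzy_def by (rule Max_ge) (simp_all add: finite_joining_pairs)

text \<open>All is read off the levels: for positive \<alpha> they are finite, hence closed; at
  \<mu> the level is nonempty, and beyond \<mu> it is empty.\<close>

lemma joining_fuzzy_in_fuzzy_sets_height:
  assumes A: "A \<in> fuzzy_sets_height \<mu>" and B: "B \<in> fuzzy_sets_height \<mu>" and \<mu>: "\<mu> \<in> {0<..1}"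
  shows "joining_fuzzy A B \<in> fuzzy_sets_height \<mu>"
proof -
  let ?C = "joining_fuzzy A B"
  have usc: "upper_semicontinuous A" "upper_semicontinuous B"
    using A B by (auto simp: fuzzy_sets_height_def fuzzy_sets_def)
  have lev: "level ?C \<alpha> = joining_set (level A \<alpha>) (level B \<alpha>)" if "\<alpha> > 0" for \<alpha>
    using level_joining_fuzzy[OF usc that] .
  have le: "?C y \<le> \<mu>" for y
  proof (rule ccontr)
    assume "\<not> ?C y \<le> \<mu>"
    then have "?C y > \<mu>" by simp
    moreover have "level A (?C y) = {}"
      using level_nonempty_iff[OF A, of "?C y"] \<open>?C y > \<mu>\<close> by auto
    moreover have "y \<in> level ?C (?C y)" by (simp add: level_def)
    ultimately show False using lev[of "?C y"] \<mu> by auto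
  qed
  have "level A \<mu> \<noteq> {}" "level B \<mu> \<noteq> {}"
    using level_nonempty_iff[OF A] level_nonempty_iff[OF B] by auto
  then have "level ?C \<mu> \<noteq> {}" using lev joining_set_nonempty \<mu> by simp
  then have "\<exists>y. ?C y = \<mu>" using le by (force simp: level_def intro: order_antisym)
  moreover have "open {y. ?C y < a}" for a
  proof (cases "a > 0")
    case True
    have "{y. ?C y < a} = - level ?C a" by (auto simp: level_def)
    then show ?thesis
      using lev[OF True] finite_joining_set by (simp add: finite_imp_closed open_Compl)
  next
    case False
    then have "\<not> ?C y < a" for y using joining_fuzzy_nonneg[of A B y] by linarith
    then have "{y. ?C y < a} = {}" by simp
    then show ?thesis by simp
  qed
  moreover have "range ?C \<subseteq> {0..1}"
    using joining_fuzzy_nonneg le \<mu> by (fastforce intro: order_trans)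
  ultimately show ?thesis
    using le by (simp add: fuzzy_sets_height_def fuzzy_sets_def upper_semicontinuous_def)
qed

end

section \<open>Weak mixing of the induced systems\<close>

lemma hyper_map_funpow: "(hyper_map T ^^ n) A = (T ^^ n) ` A"
  by (induction n) (auto simp: hyper_map_def image_comp)

text \<open>Both claims are proved in one induction, because the level formula for the next iterate
  requires the current one to be upper semicontinuous.\<close>

lemma zadeh_funpow_height_and_level:
  fixes T :: "'a::metric_space \<Rightarrow> 'a"
  assumes "compact (UNIV :: 'a set)" "continuous_on UNIV T" "surj T" "A \<in> fuzzy_sets_height \<mu>"
  shows "(zadeh T ^^ n) A \<in> fuzzy_sets_height \<mu> \<and>
    level ((zadeh T ^^ n) A) \<alpha> = (T ^^ n) ` level A \<alpha>"
proof (induction n)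
  case (Suc n)
  then have "upper_semicontinuous ((zadeh T ^^ n) A)"
    by (simp add: fuzzy_sets_height_def fuzzy_sets_def)
  then show ?case
    using Suc level_zadeh[OF assms(1-3)] zadeh_in_fuzzy_sets_height[OF assms(1-3)]
    by (simp add: image_comp comp_def)
qed (simp add: assms(4))

lemma weakly_mixing_imp_weakly_mixing_hyper:
  fixes T :: "'a::metric_space \<Rightarrow> 'a"
  assumes X: "compact (UNIV :: 'a set)" "\<exists>x y :: 'a. x \<noteq> y"
    and T: "continuous_on UNIV T" and wm: "weakly_mixing euclidean T"
  shows "weakly_mixing hyper_topology (hyper_map T)"
  unfolding hyper_topology_def
proof (rule Metric_space.weakly_mixing_if_uniform_hitting[OF Metric_space_hyperspace[OF X]])
  fix r :: real assume "r > 0"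
  \<comment> \<open>A net of mesh \<open>r / 3\<close> gives distances at most
    \<open>2 * (r / 3)\<close>, strictly below \<open>r\<close>.\<close>
  then obtain n F u where "orbit_net T (r / 3) n F u"
    using weakly_mixing_imp_orbit_net[OF X(1) T wm, of "r / 3"] by auto
  then interpret orbit_net T "r / 3" n F u .
  have "\<exists>C\<in>hyperspace. (hyper_map T ^^ n) C \<in> hyperspace \<and>
      hausdorff_dist P C < r \<and> hausdorff_dist Q ((hyper_map T ^^ n) C) < r"
    if "P \<in> hyperspace" "Q \<in> hyperspace" for P Q
  proof
    have PQ: "P \<noteq> {}" "Q \<noteq> {}" using that by (auto simp: hyperspace_def)
    let ?C = "joining_set P Q"
    show "?C \<in> hyperspace"
      using joining_set_nonempty[OF PQ] finite_joining_set
      by (simp add: hyperspace_def finite_imp_closed)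
    have "(hyper_map T ^^ n) ?C \<in> hyperspace"
      using joining_set_nonempty[OF PQ] finite_joining_set
      by (simp add: hyperspace_def hyper_map_funpow finite_imp_closed)
    then show "(hyper_map T ^^ n) ?C \<in> hyperspace \<and>
        hausdorff_dist P ?C < r \<and> hausdorff_dist Q ((hyper_map T ^^ n) ?C) < r"
      using hausdorff_dist_joining_set[OF PQ] hausdorff_dist_image_joining_set[OF PQ] \<open>r > 0\<close>
      by (simp add: hyper_map_funpow)
  qed
  then show "\<exists>n. \<forall>P\<in>hyperspace. \<forall>Q\<in>hyperspace. \<exists>C\<in>hyperspace. (hyper_map T ^^ n) C \<in> hyperspace \<and>
      hausdorff_dist P C < r \<and> hausdorff_dist Q ((hyper_map T ^^ n) C) < r"
    by blast
qed

text \<open>The bound for joining sets holds on every level with the same \<open>n\<close>. The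
  supremum over levels only preserves a non-strict bound, and \<open>2 * (r / 3)\<close> still lies
  below \<open>r\<close>.\<close>

lemma weakly_mixing_imp_weakly_mixing_fuzzy:
  fixes T :: "'a::metric_space \<Rightarrow> 'a"
  assumes X: "compact (UNIV :: 'a set)" "\<exists>x y :: 'a. x \<noteq> y"
    and T: "continuous_on UNIV T" "surj T" and wm: "weakly_mixing euclidean T"
    and \<mu>: "\<mu> \<in> {0<..1}"
  shows "weakly_mixing (fuzzy_topology \<mu>) (zadeh T)"
  unfolding fuzzy_topology_def
proof (rule Metric_space.weakly_mixing_if_uniform_hitting[OF Metric_space_fuzzy_sets_height[OF X]])
  fix r :: real assume "r > 0"
  then obtain n F u where "orbit_net T (r / 3) n F u"
    using weakly_mixing_imp_orbit_net[OF X(1) T(1) wm, of "r / 3"] by auto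
  then interpret orbit_net T "r / 3" n F u .
  have "\<exists>C\<in>fuzzy_sets_height \<mu>. (zadeh T ^^ n) C \<in> fuzzy_sets_height \<mu> \<and>
      levelwise_dist A C < r \<and> levelwise_dist B ((zadeh T ^^ n) C) < r"
    if A: "A \<in> fuzzy_sets_height \<mu>" and B: "B \<in> fuzzy_sets_height \<mu>" for A B
  proof
    let ?C = "joining_fuzzy A B"
    show C: "?C \<in> fuzzy_sets_height \<mu>" by (rule joining_fuzzy_in_fuzzy_sets_height[OF A B \<mu>])
    have usc: "upper_semicontinuous A" "upper_semicontinuous B"
      using A B by (auto simp: fuzzy_sets_height_def fuzzy_sets_def)
    have *: "hausdorff_dist (level A \<alpha>) (level ?C \<alpha>) \<le> 2 * (r / 3) \<and>
        hausdorff_dist (level B \<alpha>) (level ((zadeh T ^^ n) ?C) \<alpha>) \<le> 2 * (r / 3)"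
      if \<alpha>: "\<alpha> \<in> {0<..1}" for \<alpha>
    proof -
      have lev: "level ?C \<alpha> = joining_set (level A \<alpha>) (level B \<alpha>)"
        "level ((zadeh T ^^ n) ?C) \<alpha> = (T ^^ n) ` joining_set (level A \<alpha>) (level B \<alpha>)"
        using \<alpha> level_joining_fuzzy[OF usc] zadeh_funpow_height_and_level[OF X(1) T C] by auto
      show ?thesis
      proof (cases "\<alpha> \<le> \<mu>")
        case True
        then have "level A \<alpha> \<noteq> {}" "level B \<alpha> \<noteq> {}"
          using level_nonempty_iff[OF A, of \<alpha>] level_nonempty_iff[OF B, of \<alpha>] by auto
        then show ?thesis
          using lev hausdorff_dist_joining_set hausdorff_dist_image_joining_set by simp
      next
        \<comment> \<open>Above \<mu> all four levels are empty, and the distance between empty sets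
          is 0.\<close>
        case False
        then have "level A \<alpha> = {}" "level B \<alpha> = {}"
          using level_nonempty_iff[OF A, of \<alpha>] level_nonempty_iff[OF B, of \<alpha>] by auto
        then show ?thesis
          using lev \<open>r > 0\<close> by (simp add: hausdorff_dist_def)
      qed
    qed
    then have "levelwise_dist A ?C \<le> 2 * (r / 3)" "levelwise_dist B ((zadeh T ^^ n) ?C) \<le> 2 * (r / 3)"
      unfolding levelwise_dist_le_iff[OF X(1)] by auto
    then show "(zadeh T ^^ n) ?C \<in> fuzzy_sets_height \<mu> \<and>
        levelwise_dist A ?C < r \<and> levelwise_dist B ((zadeh T ^^ n) ?C) < r"
      using zadeh_funpow_height_and_level[OF X(1) T C] \<open>r > 0\<close> by auto
  qed
  then show "\<exists>n. \<forall>A\<in>fuzzy_sets_height \<mu>. \<forall>B\<in>fuzzy_sets_height \<mu>. \<exists>C\<in>fuzzy_sets_height \<mu>.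
      (zadeh T ^^ n) C \<in> fuzzy_sets_height \<mu> \<and>
      levelwise_dist A C < r \<and> levelwise_dist B ((zadeh T ^^ n) C) < r"
    by blast
qed


section \<open>From the induced systems back to the base\<close>

lemma near_point_if_hausdorff_dist_less:
  fixes A B :: "'a::metric_space set"
  assumes "compact (UNIV :: 'a set)" "x \<in> A" "B \<noteq> {}" "hausdorff_dist A B < r"
  shows "\<exists>y\<in>B. dist x y < r"
proof -
  have "infdist x B < r" using infdist_le_hausdorff_dist[OF assms(1-3)] assms(4) by simp
  then show ?thesis
    using assms(3) by (auto simp: infdist_notempty cINF_less_iff)
qed

text \<open>The two halves of the Hausdorff distance are used differently: closeness to
  \<open>{x}\<close> puts all of \<open>C\<close> near \<open>x\<close>, while closeness to
  \<open>{y, z}\<close> gives image points near \<open>y\<close> and near \<open>z\<close>. So one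
  source reaches two targets at one time.\<close>

lemma weakly_mixing_if_joined:
  fixes T :: "'a::metric_space \<Rightarrow> 'a"
  assumes X: "compact (UNIV :: 'a set)" and T: "continuous_on UNIV T" "surj T"
    and hit: "\<And>x y z r. r > 0 \<Longrightarrow> \<exists>n C. C \<noteq> {} \<and>
      hausdorff_dist {x} C < r \<and> hausdorff_dist {y, z} ((T ^^ n) ` C) < r"
  shows "weakly_mixing euclidean T"
proof (rule weakly_mixing_if_common_source[OF T])
  fix U V W :: "'a set"
  assume *: "open U" "U \<noteq> {}" "open V" "V \<noteq> {}" "open W" "W \<noteq> {}"
  have "\<exists>x r. r > 0 \<and> ball x r \<subseteq> A" if "open A" "A \<noteq> {}" for A :: "'a set"
    using that by (meson ex_in_conv openE)
  then obtain x p y q z s where xyz: "p > 0" "ball x p \<subseteq> U" "q > 0" "ball y q \<subseteq> V"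
    "s > 0" "ball z s \<subseteq> W"
    using * by meson
  define r where "r = min p (min q s)"
  have r: "r > 0" "ball x r \<subseteq> U" "ball y r \<subseteq> V" "ball z r \<subseteq> W"
    using xyz subset_ball[of r p x] subset_ball[of r q y] subset_ball[of r s z]
    by (auto simp: r_def)
  obtain n C where C: "C \<noteq> {}" "hausdorff_dist {x} C < r" "hausdorff_dist {y, z} ((T ^^ n) ` C) < r"
    using hit[OF r(1), of x y z] by (elim exE conjE)
  have "C \<subseteq> U"
  proof
    fix c assume "c \<in> C"
    then have "\<exists>x'\<in>{x}. dist c x' < r"
      using near_point_if_hausdorff_dist_less[OF X, of c C "{x}" r] C(2)
      by (simp add: hausdorff_dist_commute[OF X])
    then show "c \<in> U" using r(2) by (auto simp: dist_commute)
  qed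
  moreover have "\<exists>c\<in>C. (T ^^ n) c \<in> V" "\<exists>c\<in>C. (T ^^ n) c \<in> W"
    using near_point_if_hausdorff_dist_less[OF X, of y "{y, z}" "(T ^^ n) ` C" r]
      near_point_if_hausdorff_dist_less[OF X, of z "{y, z}" "(T ^^ n) ` C" r] C r(3,4) by auto
  ultimately have "n \<in> hitting_times T U V \<inter> hitting_times T U W"
    by (auto simp: hitting_times_iff)
  then show "hitting_times T U V \<inter> hitting_times T U W \<noteq> {}" by blast
qed

lemma top_transitive_hyper_imp_weakly_mixing:
  fixes T :: "'a::metric_space \<Rightarrow> 'a"
  assumes X: "compact (UNIV :: 'a set)" "\<exists>x y :: 'a. x \<noteq> y" and T: "continuous_on UNIV T" "surj T"
    and tr: "top_transitive hyper_topology (hyper_map T)"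
  shows "weakly_mixing euclidean T"
proof (rule weakly_mixing_if_joined[OF X(1) T])
  fix x y z :: 'a and r :: real
  assume "r > 0"
  moreover have "{x} \<in> hyperspace" "{y, z} \<in> hyperspace" by (auto simp: hyperspace_def)
  ultimately obtain n C where "C \<in> hyperspace" "hausdorff_dist {x} C < r"
    "hausdorff_dist {y, z} ((hyper_map T ^^ n) C) < r"
    using Metric_space.top_transitive_mballs[OF Metric_space_hyperspace[OF X]
        tr[unfolded hyper_topology_def]] by metis
  then show "\<exists>n C. C \<noteq> {} \<and> hausdorff_dist {x} C < r \<and> hausdorff_dist {y, z} ((T ^^ n) ` C) < r"
    by (auto simp: hyper_map_funpow hyperspace_def)
qed

text \<open>Strict sublevel sets of an indicator are empty, the complement of \<open>P\<close>, or
  everything. Such fuzzy sets carry \<open>{x}\<close> and \<open>{y, z}\<close> over from the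
  hyperspace.\<close>

lemma indicator_in_fuzzy_sets_height:
  fixes P :: "'a::metric_space set"
  assumes "closed P" "P \<noteq> {}"
  shows "indicator P \<in> fuzzy_sets_height 1"
proof -
  have "open {x. indicator P x < a}" for a :: real
  proof -
    consider "a \<le> 0" | "0 < a" "a \<le> 1" | "a > 1" by linarith
    then show ?thesis
    proof cases
      case 1
      then have "{x. indicator P x < a} = {}" by (auto simp: indicator_def not_less)
      then show ?thesis by (simp only: open_empty)
    next
      case 2
      then have "{x. indicator P x < a} = - P" by (auto simp: indicator_def)
      then show ?thesis using assms(1) by (simp only: open_Compl)
    next
      case 3
      then have "{x. indicator P x < a} = UNIV" by (auto simp: indicator_def)
      then show ?thesis by (simp only: open_UNIV)
    qed
  qed
  then show ?thesis
    using assms(2) by (auto simp: fuzzy_sets_height_def fuzzy_sets_def upper_semicontinuous_def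
        indicator_eq_1_iff indicator_def)
qed

lemma level_indicator_1: "level (indicator P) 1 = P"
  by (auto simp: level_def indicator_def)

text \<open>Height 1 suffices: level 1 of an indicator is the set itself, and the levelwise distance
  dominates the Hausdorff distance of the levels at 1.\<close>

lemma top_transitive_fuzzy_imp_weakly_mixing:
  fixes T :: "'a::metric_space \<Rightarrow> 'a"
  assumes X: "compact (UNIV :: 'a set)" "\<exists>x y :: 'a. x \<noteq> y" and T: "continuous_on UNIV T" "surj T"
    and tr: "top_transitive (fuzzy_topology 1) (zadeh T)"
  shows "weakly_mixing euclidean T"
proof (rule weakly_mixing_if_joined[OF X(1) T])
  fix x y z :: 'a and r :: real
  assume "r > 0"
  moreover have "indicator {x} \<in> fuzzy_sets_height 1" "indicator {y, z} \<in> fuzzy_sets_height 1"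
    by (auto intro!: indicator_in_fuzzy_sets_height)
  ultimately obtain n C where C: "C \<in> fuzzy_sets_height 1" "levelwise_dist (indicator {x}) C < r"
    "levelwise_dist (indicator {y, z}) ((zadeh T ^^ n) C) < r"
    using Metric_space.top_transitive_mballs[OF Metric_space_fuzzy_sets_height[OF X]
        tr[unfolded fuzzy_topology_def]] by metis
  have one: "(1::real) \<in> {0<..1}" by simp
  have "level C 1 \<noteq> {}" using level_nonempty_iff[OF C(1), of 1] by simp
  moreover have "hausdorff_dist {x} (level C 1) < r"
    using hausdorff_dist_le_levelwise_dist[OF X(1) one, of "indicator {x}" C] C(2)
    by (simp add: level_indicator_1)
  moreover have "hausdorff_dist {y, z} ((T ^^ n) ` level C 1) < r"
    using hausdorff_dist_le_levelwise_dist[OF X(1) one, of "indicator {y, z}" "(zadeh T ^^ n) C"] C(3)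
      zadeh_funpow_height_and_level[OF X(1) T C(1)]
    by (simp add: level_indicator_1)
  ultimately show "\<exists>n C. C \<noteq> {} \<and> hausdorff_dist {x} C < r \<and> hausdorff_dist {y, z} ((T ^^ n) ` C) < r"
    by blast
qed

theorem theorem2:
  fixes T :: "'a::metric_space \<Rightarrow> 'a"
  assumes "compact (UNIV :: 'a set)"
    and "\<exists>x y :: 'a. x \<noteq> y"
    and "continuous_on UNIV T"
    and "surj T"
  shows "(weakly_mixing euclidean T \<longleftrightarrow> top_transitive hyper_topology (hyper_map T)) \<and>
    (weakly_mixing euclidean T \<longleftrightarrow> weakly_mixing hyper_topology (hyper_map T)) \<and>
    (weakly_mixing euclidean T \<longleftrightarrow>
      (\<forall>\<mu>\<in>{0<..1}. top_transitive (fuzzy_topology \<mu>) (zadeh T))) \<and>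
    (weakly_mixing euclidean T \<longleftrightarrow>
      (\<forall>\<mu>\<in>{0<..1}. weakly_mixing (fuzzy_topology \<mu>) (zadeh T)))"
proof -
  have one: "(1::real) \<in> {0<..1}" by simp
  note to_hyper = weakly_mixing_imp_weakly_mixing_hyper[OF assms(1-3)]
  note to_fuzzy = weakly_mixing_imp_weakly_mixing_fuzzy[OF assms]
  note from_hyper = top_transitive_hyper_imp_weakly_mixing[OF assms]
  note from_fuzzy = top_transitive_fuzzy_imp_weakly_mixing[OF assms]
  show ?thesis
    \<comment> \<open>All implications pass through weak mixing of the base: it gives weak mixing of
      the induced systems, hence their transitivity, which leads back to the base, for fuzzy sets
      through \<mu> = 1.\<close>
    using to_hyper to_fuzzy from_hyper from_fuzzy one weakly_mixing_imp_top_transitive by meson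
qed

end
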